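(* Let $n,k,r$ be positive integers and let $T$ be a tree with $k$ edges. If $r\ge (k-1)(k-2)$, then every $n$-vertex $r$-uniform multi-hypergraph containing no Berge copy of $T$ has at most $\frac{n(k-1)}{r}$ hyperedges, i.e. $\mathrm{ex}_r^{multi}(n,\mathcal{B}T)\le \frac{n(k-1)}{r}$. Moreover, if $r>(k-1)(k-2)$ and $T$ is not a star, then an $n$-vertex $r$-uniform multi-hypergraph with no Berge copy of $T$ has exactly $\frac{n(k-1)}{r}$ hyperedges if and only if $r$ divides $n$ and the multi-hypergraph consists of $\frac{n}{r}$ pairwise vertex-disjoint hyperedges (covering all $n$ vertices), each with multiplicity $k-1$. If $T$ is a star, equality holds exactly for the $(k-1)$-regular $r$-uniform multi-hypergraphs.
   Context: A multi-hypergraph may contain repeated hyperedges; it is $r$-uniform if every hyperedge has exactly $r$ vertices. For a graph $G$, an $r$-uniform multi-hypergraph $\mathcal{H}$ is a Berge copy of $G$ if there is an injection $f_1:V(G)\to V(\mathcal{H})$ and a bijection $f_2:E(G)\to E(\mathcal{H})$ (hyperedges counted with multiplicity) such that $\{f_1(v_1),f_1(v_2)\}\subseteq f_2(\{v_1,v_2\})$ for every edge $\{v_1,v_2\}$ of $G$; $\mathcal{B}G$ denotes the set of Berge copies of $G$. A multi-hypergraph contains a Berge copy of $G$ if some sub-multi-hypergraph of it (a subset of its hyperedges, with multiplicity) is a Berge copy of $G$. $\mathrm{ex}_r^{multi}(n,\mathcal{B}T)$ is the maximum number of hyperedges in an $n$-vertex $r$-uniform multi-hypergraph containing no Berge copy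 of $T$. A star is a tree in which one vertex is incident to all edges.
   Formalization: The condition r > k is added. It is automatic for k ≥ 4; for k ≤ 3 and r ≤ k the claim fails whenever n ≥ r, since a single hyperedge repeated arbitrarily often has too few vertices to contain a Berge copy of T. *)

theory Defs
  imports Complex_Main "HOL-Library.Multiset" "HOL-Library.Disjoint_Sets"
begin

definition simple_graph :: "'a set \<Rightarrow> 'a set set \<Rightarrow> bool" where
  "simple_graph V E \<longleftrightarrow> finite V \<and> (\<forall>e\<in>E. e \<subseteq> V \<and> card e = 2)"

definition graph_connected :: "'a set \<Rightarrow> 'a set set \<Rightarrow> bool" where
  "graph_connected V E \<longleftrightarrow>
     V \<noteq> {} \<and> (\<forall>u\<in>V. \<forall>v\<in>V. (u, v) \<in> {(x, y). {x, y} \<in> E}\<^sup>*)"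

definition graph_cycle :: "'a set set \<Rightarrow> 'a list \<Rightarrow> bool" where
  "graph_cycle E c \<longleftrightarrow> length c \<ge> 3 \<and> distinct c \<and>
     (\<forall>i<length c. {c ! i, c ! (Suc i mod length c)} \<in> E)"

definition tree :: "'a set \<Rightarrow> 'a set set \<Rightarrow> bool" where
  "tree V E \<longleftrightarrow> simple_graph V E \<and> graph_connected V E \<and> (\<nexists>c. graph_cycle E c)"

definition star :: "'a set \<Rightarrow> 'a set set \<Rightarrow> bool" where
  "star V E \<longleftrightarrow> tree V E \<and> (\<exists>c\<in>V. \<forall>e\<in>E. c \<in> e)"

text \<open>
  A multi-hypergraph is a vertex set together with a finite multiset of hyperedges, so that
  the number of hyperedges, counted with multiplicity, is the size of the multiset.
\<close>

definition uniform_multi_hypergraph :: "nat \<Rightarrow> nat \<Rightarrow> 'b set \<Rightarrow> 'b set multiset \<Rightarrow> bool" where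
  "uniform_multi_hypergraph n r V H \<longleftrightarrow>
     finite V \<and> card V = n \<and> (\<forall>h\<in>#H. h \<subseteq> V \<and> card h = r)"

text \<open>
  A bijection from the edge set \<open>EG\<close> onto the hyperedges of \<open>H\<close>, counted with multiplicity, is a
  map \<open>f2\<close> taking each hyperedge as a value exactly as often as it occurs in \<open>H\<close>, i.e. the
  multiset image of \<open>EG\<close> under \<open>f2\<close> is \<open>H\<close>.  Only finite \<open>EG\<close> are meant, since \<open>mset_set\<close> of an
  infinite set is empty.
\<close>

definition berge_copy ::
  "'a set \<Rightarrow> 'a set set \<Rightarrow> 'b set \<Rightarrow> 'b set multiset \<Rightarrow> bool" where
  "berge_copy VG EG V H \<longleftrightarrow>
     (\<exists>f1 f2. inj_on f1 VG \<and> f1 ` VG \<subseteq> V \<and> image_mset f2 (mset_set EG) = H \<and>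
        (\<forall>v1 v2. {v1, v2} \<in> EG \<longrightarrow> {f1 v1, f1 v2} \<subseteq> f2 {v1, v2}))"

definition contains_berge ::
  "'a set \<Rightarrow> 'a set set \<Rightarrow> 'b set \<Rightarrow> 'b set multiset \<Rightarrow> bool" where
  "contains_berge VG EG V H \<longleftrightarrow> (\<exists>H'. H' \<subseteq># H \<and> berge_copy VG EG V H')"

text \<open>
  Natural numbers serve as vertices, which loses nothing up to isomorphism.  \<open>Max\<close> is meaningful
  only if the set of sizes is bounded.
\<close>

definition ex_multi :: "nat \<Rightarrow> nat \<Rightarrow> 'a set \<Rightarrow> 'a set set \<Rightarrow> nat" where
  "ex_multi r n VG EG =
     Max {size H | (V :: nat set) H.
            uniform_multi_hypergraph n r V H \<and> \<not> contains_berge VG EG V H}"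

definition hdegree :: "'b set multiset \<Rightarrow> 'b \<Rightarrow> nat" where
  "hdegree H v = size {#h \<in># H. v \<in> h#}"

definition regular_multi_hypergraph :: "nat \<Rightarrow> 'b set \<Rightarrow> 'b set multiset \<Rightarrow> bool" where
  "regular_multi_hypergraph d V H \<longleftrightarrow> (\<forall>v\<in>V. hdegree H v = d)"

definition disjoint_repeated_hyperedges ::
  "nat \<Rightarrow> nat \<Rightarrow> 'b set \<Rightarrow> 'b set multiset \<Rightarrow> bool" where
  "disjoint_repeated_hyperedges q m V H \<longleftrightarrow>
     card (set_mset H) = q \<and> disjoint (set_mset H) \<and> \<Union>(set_mset H) = V \<and>
     (\<forall>h\<in>#H. count H h = m)"

end

theory Submission
  imports Defs
begin

text \<open>
  For a star, a greedy choice of leaves shows that a Berge copy exists as soon as some degree is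
  at least \<open>k\<close>, and the degrees sum to \<open>r\<close> times the number of hyperedges.

  If \<open>T\<close> is not a star, it has two leaves \<open>p\<close>, \<open>q\<close> with distinct neighbours \<open>x\<close>, \<open>y\<close>; let \<open>W\<close>
  be the remaining \<open>k - 1\<close> vertices.  For \<open>A \<subseteq> V\<close> and a set \<open>B\<close> of hyperedges consider
  \<open>(k - 1) e(A, B) - (k - 1) (k - 2) |A| - r |B|\<close>, where \<open>e\<close> counts incidences; for the whole
  hypergraph it equals \<open>(k - 2) (r |H| - (k - 1) n)\<close>.  Vertices with at most \<open>k - 2\<close> hyperedges and
  hyperedges with at most \<open>k - 2\<close> vertices can be removed without decreasing it, by
  \<open>r \<ge> (k - 1) (k - 2)\<close>.  In what remains \<open>W\<close> embeds greedily from any starting vertex.  The two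
  leaves can then be added inside the full hyperedges unless the images of \<open>x\<close> and \<open>y\<close> have the
  same \<open>k - 1\<close> incident hyperedges, among them all those used.  As this happens for every
  embedding, each component is a set \<open>C\<close> of vertices joined to \<open>k - 1\<close> hyperedges.  It contributes
  \<open>(k - 1) (|C| - r) \<le> 0\<close>, with equality only if \<open>C\<close> itself is a hyperedge of multiplicity \<open>k - 1\<close>.
\<close>

subsection \<open>Trees and their leaves\<close>

definition induced_edges :: "'a set set \<Rightarrow> 'a set \<Rightarrow> 'a set set" where
  "induced_edges E S = {e \<in> E. e \<subseteq> S}"

definition connected_on :: "'a set set \<Rightarrow> 'a set \<Rightarrow> bool" where
  "connected_on E S \<longleftrightarrow> graph_connected S (induced_edges E S)"

lemma tree_edgeD:
  assumes "tree V E" and "e \<in> E"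
  shows "e \<subseteq> V" and "card e = 2"
  using assms by (auto simp: tree_def simple_graph_def)

lemma tree_edge_neq:
  assumes "tree V E" and "{u, w} \<in> E"
  shows "u \<noteq> w"
  using tree_edgeD(2)[OF assms] by auto

lemma tree_finite:
  assumes "tree V E"
  shows "finite V" and "finite E"
proof -
  show "finite V" using assms by (simp add: tree_def simple_graph_def)
  then show "finite E"
    using tree_edgeD(1)[OF assms] by (meson finite_Pow_iff finite_subset PowI subsetI)
qed

lemma induced_edges_all:
  assumes "tree V E"
  shows "induced_edges E V = E"
  using tree_edgeD(1)[OF assms] by (auto simp: induced_edges_def)

lemma induced_edges_singleton:
  assumes "tree V E"
  shows "induced_edges E {x} = {}"
proof -
  have False if "e \<in> E" "e \<subseteq> {x}" for e
    using tree_edgeD(2)[OF assms that(1)] card_mono[OF _ that(2)] by simp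
  then show ?thesis by (auto simp: induced_edges_def)
qed

lemma tree_connected_on: "tree V E \<Longrightarrow> connected_on E V"
  by (simp add: connected_on_def induced_edges_all) (simp add: tree_def)

lemma connected_on_singleton: "connected_on E {c}"
  by (simp add: connected_on_def graph_connected_def)

lemma connected_on_insert:
  assumes "connected_on E S" and "{u, w} \<in> E" and "u \<in> S"
  shows "connected_on E (insert w S)"
proof -
  let ?R = "{(x, y). {x, y} \<in> induced_edges E S}"
  let ?R' = "{(x, y). {x, y} \<in> induced_edges E (insert w S)}"
  have sub: "?R \<subseteq> ?R'" by (auto simp: induced_edges_def)
  have "(u, w) \<in> ?R'" "(w, u) \<in> ?R'"
    using assms(2,3) by (auto simp: induced_edges_def insert_commute)
  moreover have "(a, b) \<in> ?R'\<^sup>*" if "a \<in> S" "b \<in> S" for a b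
    using assms(1) that rtrancl_mono[OF sub]
    unfolding connected_on_def graph_connected_def by blast
  ultimately have "(a, u) \<in> ?R'\<^sup>* \<and> (u, a) \<in> ?R'\<^sup>*" if "a \<in> insert w S" for a
    using that assms(3) by blast
  then show ?thesis
    unfolding connected_on_def graph_connected_def by (blast intro: rtrancl_trans)
qed

text \<open>A path from a vertex of \<open>S\<close> to one outside must leave \<open>S\<close> at
  some step. In \<open>embedding_extend\<close> this yields the next tree vertex to place.\<close>

lemma crossing_edge:
  assumes "connected_on E V" and "S \<subset> V" and "S \<noteq> {}"
  obtains u w where "u \<in> S" "w \<in> V - S" "{u, w} \<in> E"
proof -
  obtain a b where ab: "a \<in> S" "b \<in> V" "b \<notin> S" using assms(2,3) by blast
  have "(a, b) \<in> {(x, y). {x, y} \<in> induced_edges E V}\<^sup>*"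
    using assms(1,2) ab unfolding connected_on_def graph_connected_def by blast
  then have "\<exists>u w. u \<in> S \<and> w \<in> V - S \<and> {u, w} \<in> E" using ab(3)
  proof (induction rule: rtrancl_induct)
    case base
    then show ?case using ab(1) by simp
  next
    case (step y z)
    then show ?case by (cases "y \<in> S") (auto simp: induced_edges_def)
  qed
  then show ?thesis using that by blast
qed

text \<open>The path grows step by step; when the next vertex already lies on it, it is cut back to
  that vertex instead, which keeps it distinct.\<close>

lemma rtrancl_distinct_path:
  assumes "(u, v) \<in> {(x, y). {x, y} \<in> F}\<^sup>*" and "u \<in> S" and "\<Union>F \<subseteq> S"
  obtains p where "p \<noteq> []" "hd p = u" "last p = v" "distinct p" "set p \<subseteq> S"
    "\<And>i. Suc i < length p \<Longrightarrow> {p ! i, p ! Suc i} \<in> F"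
proof -
  have "\<exists>p. p \<noteq> [] \<and> hd p = u \<and> last p = v \<and> distinct p \<and> set p \<subseteq> S \<and>
    (\<forall>i. Suc i < length p \<longrightarrow> {p ! i, p ! Suc i} \<in> F)"
    using assms(1)
  proof (induction rule: rtrancl_induct)
    case base
    show ?case using assms(2) by (intro exI[of _ "[u]"]) auto
  next
    case (step y z)
    then obtain p where p: "p \<noteq> []" "hd p = u" "last p = y" "distinct p" "set p \<subseteq> S"
      "\<forall>i. Suc i < length p \<longrightarrow> {p ! i, p ! Suc i} \<in> F" by blast
    have yz: "{y, z} \<in> F" using step by simp
    show ?case
    proof (cases "z \<in> set p")
      case True
      then obtain j where j: "j < length p" "p ! j = z" by (auto simp: in_set_conv_nth)
      let ?q = "take (Suc j) p"
      have "last ?q = z" using j by (simp add: take_Suc_conv_app_nth)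
      moreover have "set ?q \<subseteq> S" using p(5) set_take_subset[of "Suc j" p] by blast
      moreover have "hd ?q = u" using p(2) by simp
      ultimately show ?thesis using p j by (intro exI[of _ ?q]) auto
    next
      case False
      have "{(p @ [z]) ! i, (p @ [z]) ! Suc i} \<in> F" if "Suc i < length (p @ [z])" for i
      proof (cases "Suc i < length p")
        case True
        then show ?thesis using p(6) by (simp add: nth_append)
      next
        case False
        then have "i = length p - 1" "Suc i = length p" using that by auto
        then show ?thesis
          using yz p(1,3) by (simp add: nth_append last_conv_nth)
      qed
      then show ?thesis
        using p False yz assms(3) by (intro exI[of _ "p @ [z]"]) auto
    qed
  qed
  then show ?thesis using that by blast
qed

text \<open>A path inside \<open>S\<close> between two different neighbours of \<open>w\<close>
  would close up to a cycle through \<open>w\<close>.\<close>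

lemma tree_unique_neighbour:
  assumes "tree V E" and "connected_on E S" and "w \<notin> S"
    and "u \<in> S" "{u, w} \<in> E" and "u' \<in> S" "{u', w} \<in> E"
  shows "u = u'"
proof (rule ccontr)
  assume neq: "u \<noteq> u'"
  have "(u, u') \<in> {(x, y). {x, y} \<in> induced_edges E S}\<^sup>*"
    using assms(2,4,6) unfolding connected_on_def graph_connected_def by blast
  moreover have "\<Union>(induced_edges E S) \<subseteq> S" by (auto simp: induced_edges_def)
  ultimately obtain p where p: "p \<noteq> []" "hd p = u" "last p = u'" "distinct p" "set p \<subseteq> S"
    and edge: "\<And>i. Suc i < length p \<Longrightarrow> {p ! i, p ! Suc i} \<in> induced_edges E S"
    using assms(4) by (elim rtrancl_distinct_path) blast+
  have len: "2 \<le> length p"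
    using p(1-3) neq by (cases p; cases "tl p") auto
  have "{(w # p) ! i, (w # p) ! (Suc i mod length (w # p))} \<in> E" if "i < length (w # p)" for i
  proof (cases i)
    case 0
    then show ?thesis using p(1,2) assms(5) by (simp add: hd_conv_nth insert_commute)
  next
    case (Suc j)
    show ?thesis
    proof (cases "Suc j < length p")
      case True
      then show ?thesis using Suc edge[of j] by (simp add: induced_edges_def)
    next
      case False
      then have len_p: "length p = Suc j" using Suc that by simp
      have "(w # p) ! i = last p" using Suc len_p p(1) by (simp add: last_conv_nth)
      then show ?thesis using assms(7) p(3) Suc len_p by simp
    qed
  qed
  then have "graph_cycle E (w # p)"
    using len p(4,5) assms(3) by (auto simp: graph_cycle_def)
  then show False using assms(1) by (auto simp: tree_def)
qed

text \<open>By \<open>tree_unique_neighbour\<close> the new vertex brings exactly one edge, so a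
  partial copy that grows by one vertex consumes one more hyperedge.\<close>

lemma induced_edges_insert:
  assumes "tree V E" and "connected_on E S" and "u \<in> S" and "w \<notin> S" and "{u, w} \<in> E"
  shows "induced_edges E (insert w S) = insert {u, w} (induced_edges E S)"
proof -
  have "e = {u, w}" if e: "e \<in> E" "e \<subseteq> insert w S" "w \<in> e" for e
  proof -
    obtain v where v: "e = {v, w}" "v \<noteq> w"
      using e(3) tree_edgeD(2)[OF assms(1) e(1)] by (auto simp: card_2_iff)
    then have "v \<in> S" using e(2) by auto
    then show ?thesis
      using tree_unique_neighbour[OF assms(1,2,4,3,5)] e(1) v(1) by auto
  qed
  then have "e \<in> insert {u, w} (induced_edges E S)" if "e \<in> induced_edges E (insert w S)" for e
    using that by (cases "w \<in> e") (auto simp only: induced_edges_def mem_Collect_eq)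
  moreover have "insert {u, w} (induced_edges E S) \<subseteq> induced_edges E (insert w S)"
    using assms(3,5) by (auto simp: induced_edges_def)
  ultimately show ?thesis by (intro equalityI subsetI) blast+
qed

lemma induced_edges_insert_notin: "w \<notin> S \<Longrightarrow> {u, w} \<notin> induced_edges E S"
  by (auto simp: induced_edges_def)

text \<open>A maximal connected proper subset containing \<open>S\<close> misses exactly one vertex.\<close>

lemma exists_leaf_outside:
  assumes "finite V" and "connected_on E V" and "connected_on E S" and "S \<subset> V"
  obtains l u where "l \<in> V - S" "u \<in> V - {l}" "{u, l} \<in> E" "connected_on E (V - {l})"
proof -
  let ?P = "\<lambda>U. S \<subseteq> U \<and> U \<subset> V \<and> connected_on E U"
  have "finite {U. ?P U}" by (rule finite_subset[of _ "Pow V"]) (use assms(1) in auto)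
  moreover have "?P S" using assms by simp
  ultimately obtain U where U: "?P U" and max: "\<And>U'. ?P U' \<Longrightarrow> U \<subseteq> U' \<Longrightarrow> U = U'"
    using finite_has_maximal2[of "{U. ?P U}" S] by auto
  have "U \<noteq> {}" using U by (auto simp: connected_on_def graph_connected_def)
  then obtain u w where uw: "u \<in> U" "w \<in> V - U" "{u, w} \<in> E"
    using crossing_edge[OF assms(2)] U by blast
  have "insert w U = V"
    using max[of "insert w U"] connected_on_insert[of E U u w] uw U by blast
  then have "V - {w} = U" using uw by blast
  then show ?thesis using that[of w u] uw U by auto
qed

text \<open>Deleting a leaf, found by \<open>exists_leaf_outside\<close>, removes one vertex and one
  edge.\<close>

lemma card_induced_edges:
  assumes "tree V E" and "S \<subseteq> V" and "connected_on E S"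
  shows "Suc (card (induced_edges E S)) = card S"
  using assms(2,3)
proof (induction "card S" arbitrary: S rule: less_induct)
  case less
  have fin: "finite S" using less.prems(1) tree_finite[OF assms(1)] finite_subset by blast
  obtain c where c: "c \<in> S"
    using less.prems(2) by (auto simp: connected_on_def graph_connected_def)
  show ?case
  proof (cases "S = {c}")
    case True
    then show ?thesis using induced_edges_singleton[OF assms(1)] by simp
  next
    case False
    then obtain l u where l: "l \<in> S - {c}" "u \<in> S - {l}" "{u, l} \<in> E" "connected_on E (S - {l})"
      using exists_leaf_outside[OF fin less.prems(2) connected_on_singleton[of E c]] c by blast
    have eq: "insert l (S - {l}) = S" using l by blast
    have "induced_edges E S = insert {u, l} (induced_edges E (S - {l}))"
      using induced_edges_insert[OF assms(1) l(4) l(2) _ l(3)] eq by simp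
    moreover have "{u, l} \<notin> induced_edges E (S - {l})" by (auto simp: induced_edges_def)
    moreover have "finite (induced_edges E (S - {l}))"
      using tree_finite(2)[OF assms(1)] by (simp add: induced_edges_def)
    moreover have "Suc (card (induced_edges E (S - {l}))) = card (S - {l})"
      using less.hyps[OF _ _ l(4)] less.prems(1) l(1) fin
      by (metis Diff_iff Diff_subset card_Diff1_less order_trans)
    moreover have "Suc (card (S - {l})) = card S"
      using l(1) fin by (intro card_Suc_Diff1) auto
    ultimately show ?thesis by simp
  qed
qed

lemma connected_on_neighbours:
  assumes "finite X" and "\<And>w. w \<in> X \<Longrightarrow> {x, w} \<in> E"
  shows "connected_on E (insert x X)"
  using assms
proof (induction rule: finite_induct)
  case empty
  show ?case by (rule connected_on_singleton)
next
  case (insert w X)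
  then have "connected_on E (insert w (insert x X))"
    using connected_on_insert[of E "insert x X" x w] by simp
  then show ?case by (simp add: insert_commute)
qed

text \<open>Take a leaf \<open>p\<close> with neighbour \<open>x\<close>. As the tree is no star,
  \<open>x\<close> and its neighbours other than \<open>p\<close> do not exhaust
  \<open>V - {p}\<close>. Deleting \<open>p\<close> therefore leaves a tree with a leaf
  \<open>q\<close> outside this set, and the neighbour \<open>y\<close> of \<open>q\<close> is not
  \<open>x\<close>.\<close>

lemma nonstar_tree_two_leaves:
  assumes tr: "tree V E" and ns: "\<not> star V E"
  obtains p q W x y where "insert p (insert q W) = V" "x \<in> W" "y \<in> W" "x \<noteq> y"
    "p \<notin> W" "q \<notin> W" "p \<noteq> q" "{x, p} \<in> E" "{y, q} \<in> E" "connected_on E W"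
proof -
  have fin: "finite V" by (rule tree_finite[OF tr])
  obtain c where c: "c \<in> V" using tr by (auto simp: tree_def graph_connected_def)
  have "V \<noteq> {c}"
  proof
    assume "V = {c}"
    moreover have "Suc (card E) = card V"
      using card_induced_edges[OF tr subset_refl tree_connected_on[OF tr]]
      by (simp add: induced_edges_all[OF tr])
    ultimately have "card E = 0" by simp
    then have "E = {}" using tree_finite(2)[OF tr] by simp
    then show False using ns tr c unfolding star_def by blast
  qed
  then have "{c} \<subset> V" using c by blast
  then obtain p x where p: "p \<in> V - {c}" "x \<in> V - {p}" "{x, p} \<in> E" "connected_on E (V - {p})"
    by (rule exists_leaf_outside[OF fin tree_connected_on[OF tr] connected_on_singleton])
  let ?N = "{w. {x, w} \<in> E}"
  let ?S = "insert x (?N - {p})"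
  have NV: "?N \<subseteq> V" using tree_edgeD(1)[OF tr] by blast
  then have finN: "finite ?N" using fin finite_subset by blast
  have conS: "connected_on E ?S" by (rule connected_on_neighbours) (use finN in auto)
  have "?S \<noteq> V - {p}"
  proof
    assume eq: "?S = V - {p}"
    have nb: "v \<in> ?N" if "v \<in> V" "v \<noteq> x" for v
    proof (cases "v = p")
      case False
      then have "v \<in> ?S" using that(1) by (subst eq) blast
      then show ?thesis using that(2) by blast
    qed (use p(3) in blast)
    \<comment> \<open>All other vertices being adjacent to \<open>x\<close>, an edge avoiding
      \<open>x\<close> would form a triangle with it. So \<open>x\<close> would be the centre of a
      star.\<close>
    have "x \<in> e" if e: "e \<in> E" for e
    proof (rule ccontr)
      assume nx: "x \<notin> e"
      obtain a b where ab: "e = {a, b}" "a \<noteq> b"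
        using tree_edgeD(2)[OF tr e] by (auto simp: card_2_iff)
      then have "a \<in> V" "b \<in> V" "a \<noteq> x" "b \<noteq> x"
        using nx tree_edgeD(1)[OF tr e] by auto
      then have N: "{x, a} \<in> E" "{x, b} \<in> E" using nb by blast+
      then have "connected_on E {x, a}"
        using connected_on_neighbours[of "{a}" x E] by simp
      then have "x = a"
        using tree_unique_neighbour[OF tr, of "{x, a}" b x a] N ab e \<open>b \<noteq> x\<close> by simp
      then show False using nx ab by simp
    qed
    then show False using ns tr p(2) unfolding star_def by blast
  qed
  moreover have "?S \<subseteq> V - {p}" using NV p(2) by auto
  ultimately have sub: "?S \<subset> V - {p}" by (simp only: psubset_eq simp_thms)
  obtain q y where q: "q \<in> V - {p} - ?S" "y \<in> V - {p} - {q}" "{y, q} \<in> E"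
      "connected_on E (V - {p} - {q})"
    by (rule exists_leaf_outside[OF finite_Diff[OF fin] p(4) conS sub])
  have "q \<noteq> x" "q \<noteq> p" "q \<in> V" "{x, q} \<notin> E" using q(1) by auto
  moreover have "x \<noteq> y" using \<open>{x, q} \<notin> E\<close> q(3) by blast
  moreover have "insert p (insert q (V - {p} - {q})) = V"
    using insert_Diff[of q "V - {p}"] insert_Diff[of p V] p(1) q(1) by simp
  ultimately show ?thesis using that[of p q "V - {p} - {q}" x y] p(2,3) q(2-4) by simp
qed

subsection \<open>Greedy embeddings\<close>

text \<open>Hyperedges are indexed so that copies of a repeated hyperedge become different indices;
  using distinct hyperedges is then injectivity of a map into \<open>I\<close>.\<close>

locale uniform_family =
  fixes V :: "'b set" and I :: "'i set" and h :: "'i \<Rightarrow> 'b set" and r :: nat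
  assumes finite_vertices: "finite V" and finite_index: "finite I"
    and hyperedge_subset: "i \<in> I \<Longrightarrow> h i \<subseteq> V"
    and hyperedge_card: "i \<in> I \<Longrightarrow> card (h i) = r"
begin

definition incident :: "'b \<Rightarrow> 'i set" where
  "incident v = {i \<in> I. v \<in> h i}"

text \<open>A Berge copy of the part of the tree induced on \<open>S\<close>. Admitting any
  \<open>S\<close> gives the partial copies that the greedy arguments extend.\<close>

definition embedding :: "'a set set \<Rightarrow> 'a set \<Rightarrow> ('a \<Rightarrow> 'b) \<Rightarrow> ('a set \<Rightarrow> 'i) \<Rightarrow> bool" where
  "embedding E S f g \<longleftrightarrow> inj_on f S \<and> f ` S \<subseteq> V \<and>
     inj_on g (induced_edges E S) \<and> g ` induced_edges E S \<subseteq> I \<and>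
     (\<forall>e\<in>induced_edges E S. f ` e \<subseteq> h (g e))"

lemma finite_incident: "finite (incident v)"
  using finite_index by (simp add: incident_def)

lemma finite_hyperedge: "i \<in> I \<Longrightarrow> finite (h i)"
  using finite_vertices hyperedge_subset finite_subset by blast

lemma embedding_insert:
  assumes tr: "tree VT E" and con: "connected_on E S" and uw: "u \<in> S" "w \<notin> S" "{u, w} \<in> E"
    and emb: "embedding E S f g"
    and i: "i \<in> incident (f u)" "i \<notin> g ` induced_edges E S" and b: "b \<in> h i" "b \<notin> f ` S"
  shows "embedding E (insert w S) (f(w := b)) (g({u, w} := i))"
proof -
  note ins = induced_edges_insert[OF tr con uw]
  have notin: "{u, w} \<notin> induced_edges E S" by (rule induced_edges_insert_notin[OF uw(2)])
  have iI: "i \<in> I" "f u \<in> h i" using i(1) by (auto simp: incident_def)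
  have fS: "(f(w := b)) ` T = f ` T" if "T \<subseteq> S" for T
    using uw(2) that by (intro image_cong) auto
  have gS: "(g({u, w} := i)) ` induced_edges E S = g ` induced_edges E S"
    using notin by (intro image_cong) auto
  have "inj_on (f(w := b)) (insert w S)"
    using emb b(2) uw(2) by (auto simp: embedding_def inj_on_def)
  moreover have "(f(w := b)) ` insert w S \<subseteq> V"
    using emb b(1) hyperedge_subset[OF iI(1)] fS[OF order_refl] by (auto simp: embedding_def)
  moreover have "inj_on (g({u, w} := i)) (insert {u, w} (induced_edges E S))"
  proof -
    have "inj_on (g({u, w} := i)) (induced_edges E S)"
      using emb i(2) by (intro inj_on_fun_updI) (auto simp: embedding_def)
    then show ?thesis using i(2) gS notin by (simp add: inj_on_insert)
  qed
  moreover have "(g({u, w} := i)) ` insert {u, w} (induced_edges E S) \<subseteq> I"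
    using emb iI(1) gS by (auto simp: embedding_def)
  moreover have "(f(w := b)) ` e \<subseteq> h ((g({u, w} := i)) e)" if "e \<in> insert {u, w} (induced_edges E S)" for e
  proof (cases "e = {u, w}")
    case True
    then show ?thesis using iI(2) b(1) uw(1,2) by auto
  next
    case False
    then have e: "e \<in> induced_edges E S" using that by simp
    then have "e \<subseteq> S" by (simp add: induced_edges_def)
    then show ?thesis using False fS e emb by (simp add: embedding_def)
  qed
  ultimately show ?thesis unfolding embedding_def ins by (intro conjI ballI)
qed

lemma embedding_singleton:
  assumes "tree VT E" and "v \<in> V"
  shows "embedding E {x} (\<lambda>_. v) g"
  using assms(2) induced_edges_singleton[OF assms(1)] by (simp add: embedding_def)

lemma card_embedding_image:
  assumes "tree VT E" and "S \<subseteq> VT" and "connected_on E S" and "embedding E S f g"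
  shows "card (f ` S) = card S" and "Suc (card (g ` induced_edges E S)) = card S"
  using assms card_induced_edges[OF assms(1-3)] by (auto simp: embedding_def card_image)

lemma embedding_extend:
  assumes tr: "tree VT E" and W: "W \<subseteq> VT" "connected_on E W"
    and A: "A \<subseteq> V" and B: "B \<subseteq> I"
    and degA: "\<And>a. a \<in> A \<Longrightarrow> card W \<le> card (incident a \<inter> B)"
    and degB: "\<And>i. i \<in> B \<Longrightarrow> card W \<le> card (h i \<inter> A)"
    and S: "S \<subseteq> W" "connected_on E S" and emb: "embedding E S f g" and fA: "f ` S \<subseteq> A"
  obtains f' g' where "embedding E W f' g'" "f' ` W \<subseteq> A"
    "\<And>x. x \<in> S \<Longrightarrow> f' x = f x" "\<And>e. e \<in> induced_edges E S \<Longrightarrow> g' e = g e"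
proof -
  have finW: "finite W" using W(1) tree_finite(1)[OF tr] finite_subset by blast
  have "\<exists>f' g'. embedding E W f' g' \<and> f' ` W \<subseteq> A \<and> (\<forall>x\<in>S. f' x = f x) \<and>
      (\<forall>e\<in>induced_edges E S. g' e = g e)"
    using S emb fA
  proof (induction "card (W - S)" arbitrary: S f g rule: less_induct)
    case less
    show ?case
    proof (cases "S = W")
      case True
      then show ?thesis using less.prems by blast
    next
      case False
      then have SW: "S \<subset> W" using less.prems(1) by blast
      have "S \<noteq> {}" using less.prems(2) by (auto simp: connected_on_def graph_connected_def)
      then obtain u w where uw: "u \<in> S" "w \<in> W - S" "{u, w} \<in> E"
        by (rule crossing_edge[OF W(2) SW])
      have SV: "S \<subseteq> VT" using SW W(1) by blast
      note cards = card_embedding_image[OF tr SV less.prems(2,3)]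
      have lt: "card S < card W" by (rule psubset_card_mono[OF finW SW])
      have finS: "finite S" using finW SW finite_subset by blast
      have finI: "finite (induced_edges E S)"
        using tree_finite(2)[OF tr] by (simp add: induced_edges_def)
      have "f u \<in> A" using less.prems(4) uw(1) by blast
      then have "card (g ` induced_edges E S) < card (incident (f u) \<inter> B)"
        using degA[of "f u"] cards(2) lt by simp
      then have "\<not> incident (f u) \<inter> B \<subseteq> g ` induced_edges E S"
        using card_mono[of "g ` induced_edges E S" "incident (f u) \<inter> B"] finI by auto
      then obtain i where i: "i \<in> incident (f u)" "i \<in> B" "i \<notin> g ` induced_edges E S" by blast
      have "card (f ` S) < card (h i \<inter> A)"
        using degB[OF i(2)] cards(1) lt by simp
      then have "\<not> h i \<inter> A \<subseteq> f ` S"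
        using card_mono[of "f ` S" "h i \<inter> A"] finS by auto
      then obtain b where b: "b \<in> h i" "b \<in> A" "b \<notin> f ` S" by blast
      have wS: "w \<notin> S" using uw(2) by simp
      have emb': "embedding E (insert w S) (f(w := b)) (g({u, w} := i))"
        by (rule embedding_insert[OF tr less.prems(2) uw(1) wS uw(3) less.prems(3) i(1,3) b(1,3)])
      have "(f(w := b)) ` insert w S \<subseteq> A"
        using less.prems(4) b(2) by auto
      moreover have "card (W - insert w S) < card (W - S)"
        using uw(2) finW by (intro psubset_card_mono) auto
      moreover have "connected_on E (insert w S)"
        by (rule connected_on_insert[OF less.prems(2) uw(3,1)])
      moreover have "insert w S \<subseteq> W" using uw(2) less.prems(1) by blast
      ultimately obtain f' g' where
        fg: "embedding E W f' g'" "f' ` W \<subseteq> A" "\<forall>x\<in>insert w S. f' x = (f(w := b)) x"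
          "\<forall>e\<in>induced_edges E (insert w S). g' e = (g({u, w} := i)) e"
        using less.hyps[of "insert w S" "f(w := b)" "g({u, w} := i)"] emb' by blast
      have "f' x = f x" if "x \<in> S" for x using fg(3) that wS by auto
      moreover have "g' e = g e" if "e \<in> induced_edges E S" for e
      proof -
        have "e \<in> induced_edges E (insert w S)" "e \<noteq> {u, w}"
          using that wS by (auto simp: induced_edges_def)
        then show ?thesis using fg(4) by simp
      qed
      ultimately show ?thesis using fg(1,2) by blast
    qed
  qed
  then show ?thesis using that by blast
qed

end

subsection \<open>Trees that are not stars\<close>

text \<open>For a tree with \<open>k\<close> edges, \<open>d\<close> stands for
  \<open>k - 2\<close>: the core \<open>W\<close> has \<open>k - 1\<close> vertices, and
  \<open>large\<close> reads \<open>k < r\<close> and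
  \<open>(k - 1) * (k - 2) \<le> r\<close>.\<close>

locale nonstar_free_family = uniform_family V I h r
  for V :: "'b set" and I :: "'i set" and h r +
  fixes VT :: "'a set" and ET W p q x y and d :: nat
  assumes tree: "tree VT ET" and vertices: "insert p (insert q W) = VT"
    and xy: "x \<in> W" "y \<in> W" "x \<noteq> y" and pq: "p \<notin> W" "q \<notin> W" "p \<noteq> q"
    and leaf_edges: "{x, p} \<in> ET" "{y, q} \<in> ET"
    and connected_core: "connected_on ET W"
    and card_core: "card W = Suc d"
    and large: "Suc (Suc d) < r" "Suc d * d \<le> r"
    and free: "\<not> embedding ET VT f g"
begin

lemma core_subset: "W \<subseteq> VT"
  using vertices by blast

text \<open>The core contains the distinct vertices \<open>x\<close> and \<open>y\<close>.
  Positivity allows the factor \<open>d\<close> to be cancelled in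
  \<open>nonstar_bound\<close>.\<close>

lemma d_pos: "d > 0"
proof -
  have "finite W" using card_core by (intro card_ge_0_finite) simp
  then have "card {x, y} \<le> card W" using xy by (intro card_mono) auto
  then show ?thesis using card_core xy(3) by simp
qed

text \<open>A hyperedge has more than \<open>Suc (Suc d)\<close> vertices, and no more than that
  many are occupied when either of the two leaves is placed.\<close>

lemma exists_new_vertex:
  assumes "i \<in> I" and "card U \<le> Suc (Suc d)" and "finite U"
  obtains b where "b \<in> h i" "b \<notin> U"
proof -
  have "\<not> h i \<subseteq> U"
    using card_mono[OF assms(3), of "h i"] assms(2) hyperedge_card[OF assms(1)] large(1) by auto
  then show ?thesis using that by blast
qed

text \<open>Two distinct unused hyperedges at the images of \<open>x\<close> and \<open>y\<close> would complete the tree.\<close>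

lemma embedding_core_stuck:
  assumes emb: "embedding ET W f g"
    and deg: "Suc d \<le> card (incident (f x))" "Suc d \<le> card (incident (f y))"
  shows "incident (f x) = incident (f y)" and "card (incident (f x)) = Suc d"
    and "g ` induced_edges ET W \<subseteq> incident (f x)"
proof -
  let ?U = "g ` induced_edges ET W"
  note cards = card_embedding_image[OF tree core_subset connected_core emb]
  have cU: "card ?U = d" using cards(2) card_core by simp
  have finU: "finite ?U" using tree_finite(2)[OF tree] by (simp add: induced_edges_def)
  have finW: "finite W" using card_core by (intro card_ge_0_finite) simp
  have same: "i = j" if i: "i \<in> incident (f x)" "i \<notin> ?U" and j: "j \<in> incident (f y)" "j \<notin> ?U" for i j
  proof (rule ccontr)
    assume ij: "i \<noteq> j"
    have iI: "i \<in> I" "j \<in> I" using i j by (auto simp: incident_def)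
    have "card (f ` W) \<le> Suc (Suc d)" using cards(1) card_core by simp
    then obtain b where b: "b \<in> h j" "b \<notin> f ` W"
      using exists_new_vertex[OF iI(2), of "f ` W"] finW by blast
    let ?f = "f(q := b)" and ?g = "g({y, q} := j)" and ?W = "insert q W"
    have emb1: "embedding ET ?W ?f ?g"
      by (rule embedding_insert[OF tree connected_core xy(2) pq(2) leaf_edges(2) emb j b])
    have con1: "connected_on ET ?W"
      by (rule connected_on_insert[OF connected_core leaf_edges(2) xy(2)])
    have "card ?W \<le> Suc (Suc d)" using finW card_core pq(2) by simp
    then have "card (?f ` ?W) \<le> Suc (Suc d)" using card_image_le[of ?W ?f] finW by simp
    then obtain c where c: "c \<in> h i" "c \<notin> ?f ` ?W"
      using exists_new_vertex[OF iI(1), of "?f ` ?W"] finW by blast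
    have "i \<notin> ?g ` induced_edges ET ?W"
      unfolding induced_edges_insert[OF tree connected_core xy(2) pq(2) leaf_edges(2)]
      using i(2) ij by auto
    moreover have "i \<in> incident (?f x)" using i(1) xy(1) pq(2) by auto
    moreover have "x \<in> ?W" "p \<notin> ?W" using xy(1) pq by auto
    ultimately have "embedding ET (insert p ?W) (?f(p := c)) (?g({x, p} := i))"
      using embedding_insert[OF tree con1 _ _ leaf_edges(1) emb1 _ _ c] by blast
    then show False using free vertices by simp
  qed
  have ne: "\<exists>i. i \<in> incident v \<and> i \<notin> ?U" if "Suc d \<le> card (incident v)" for v
  proof -
    have "\<not> incident v \<subseteq> ?U" using card_mono[OF finU, of "incident v"] that cU by auto
    then show ?thesis by blast
  qed
  obtain i where i: "i \<in> incident (f x)" "i \<notin> ?U" using ne[OF deg(1)] by blast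
  obtain j where j: "j \<in> incident (f y)" "j \<notin> ?U" using ne[OF deg(2)] by blast
  have ij: "j = i" using same[OF i j] by simp
  have c: "card (insert i ?U) = Suc d" using cU finU i(2) by simp
  have "incident (f x) \<subseteq> insert i ?U" using same[OF _ _ j] ij by blast
  then have ex: "incident (f x) = insert i ?U"
    using card_seteq[of "insert i ?U" "incident (f x)"] finU c deg(1) by simp
  have "incident (f y) \<subseteq> insert i ?U" using same[OF i] by blast
  then have ey: "incident (f y) = insert i ?U"
    using card_seteq[of "insert i ?U" "incident (f y)"] finU c deg(2) by simp
  show "incident (f x) = incident (f y)" using ex ey by simp
  show "card (incident (f x)) = Suc d" using ex c by simp
  show "?U \<subseteq> incident (f x)" using ex by blast
qed

section \<open>Cores: all vertices and hyperedges have degree at least \<open>Suc d\<close>\<close>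

context
  fixes A B
  assumes A: "A \<subseteq> V" and B: "B \<subseteq> I"
    and degA: "\<And>a. a \<in> A \<Longrightarrow> Suc d \<le> card (incident a \<inter> B)"
    and degB: "\<And>i. i \<in> B \<Longrightarrow> Suc d \<le> card (h i \<inter> A)"
begin

lemma degree_core: "a \<in> A \<Longrightarrow> Suc d \<le> card (incident a)"
  using degA[of a] card_mono[OF finite_incident, of "incident a \<inter> B" a] by simp

text \<open>Every partial copy in the core that already places \<open>x\<close> extends to all of
  \<open>W\<close>, where \<open>embedding_core_stuck\<close> applies. What it says can thus be read
  off at the prescribed vertex \<open>f x\<close>.\<close>

lemma extend_stuck:
  assumes "S \<subseteq> W" "connected_on ET S" "embedding ET S f g" "f ` S \<subseteq> A" "x \<in> S"
  obtains f' g' where "\<And>v. v \<in> S \<Longrightarrow> f' v = f v" "\<And>e. e \<in> induced_edges ET S \<Longrightarrow> g' e = g e"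
    "incident (f x) = incident (f' y)" "card (incident (f x)) = Suc d"
    "g' ` induced_edges ET W \<subseteq> incident (f x)"
proof -
  obtain f' g' where fg: "embedding ET W f' g'" "f' ` W \<subseteq> A"
    "\<And>v. v \<in> S \<Longrightarrow> f' v = f v" "\<And>e. e \<in> induced_edges ET S \<Longrightarrow> g' e = g e"
    using embedding_extend[OF tree core_subset connected_core A B _ _ assms(1-4)]
      degA degB card_core by metis
  have "f' x \<in> A" "f' y \<in> A" using fg(2) xy by auto
  then show ?thesis
    using that[OF fg(3,4)] embedding_core_stuck[OF fg(1)] degree_core fg(3)[OF assms(5)] by simp
qed

text \<open>Any vertex of the core can be chosen as the image of \<open>x\<close>.\<close>

lemma card_incident_core:
  assumes "a \<in> A"
  shows "card (incident a) = Suc d"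
proof -
  have "embedding ET {x} (\<lambda>_. a) g" for g :: "'a set \<Rightarrow> 'i"
    by (rule embedding_singleton[OF tree]) (use assms A in blast)
  then show ?thesis
    using extend_stuck[of "{x}" "\<lambda>_. a"] xy(1) assms connected_on_singleton by (metis
        empty_subsetI image_constant_conv insert_subset singletonI)
qed

lemma incident_core_subset:
  assumes "a \<in> A"
  shows "incident a \<subseteq> B"
proof -
  have "incident a \<inter> B = incident a"
    using card_incident_core[OF assms] degA[OF assms]
    by (intro card_subset_eq card_seteq finite_incident) auto
  then show ?thesis by blast
qed

text \<open>Place \<open>x\<close> at \<open>a\<close>. If \<open>y\<close> is adjacent to
  \<open>x\<close>, place it at \<open>b\<close> through \<open>e\<close>; then
  \<open>extend_stuck\<close> gives the equality at once. Otherwise place another neighbour of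
  \<open>x\<close> at \<open>b\<close> and continue from there through an arbitrary hyperedge
  \<open>i\<close> at \<open>b\<close>: all hyperedges used must be incident to \<open>a\<close>, so
  \<open>i\<close> is. The inclusion is an equality because both sets have \<open>Suc d\<close>
  elements.\<close>

lemma incident_core_eq:
  assumes a: "a \<in> A" and e: "e \<in> incident a" and b: "b \<in> A" "b \<in> h e"
  shows "incident b = incident a"
proof (cases "b = a")
  case False
  have aV: "a \<in> V" using a A by blast
  have emb0: "embedding ET {x} (\<lambda>_. a) g" for g :: "'a set \<Rightarrow> 'i"
    by (rule embedding_singleton[OF tree aV])
  note ind0 = induced_edges_singleton[OF tree]
  have eI: "e \<in> I" "a \<in> h e" using e by (auto simp: incident_def)
  have edge: "embedding ET {z, x} ((\<lambda>_. a)(z := b)) ((\<lambda>_. e)({x, z} := e))"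
    if "z \<noteq> x" "{x, z} \<in> ET" for z
    by (rule embedding_insert[OF tree connected_on_singleton _ _ that(2) emb0])
      (use that e b False ind0 in auto)
  have con: "connected_on ET {z, x}" if "{x, z} \<in> ET" for z
    by (rule connected_on_insert[OF connected_on_singleton that]) simp
  show ?thesis
  proof (cases "{x, y} \<in> ET")
    case True
    then show ?thesis
      using extend_stuck[OF _ con edge[OF xy(3)[symmetric]]] a b xy by auto
  next
    case nonadjacent: False
    let ?S = "insert x {z \<in> W. {x, z} \<in> ET}"
    \<comment> \<open>As \<open>y\<close> is missing from \<open>?S\<close>, a crossing edge leads
      from a neighbour \<open>z\<close> of \<open>x\<close> to a vertex \<open>z'\<close> at
      distance two. Three vertices in \<open>W\<close> give \<open>d \<ge> 2\<close>, so each
      hyperedge of the core has a vertex of \<open>A\<close> besides \<open>a\<close> and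
      \<open>b\<close> for the image of \<open>z'\<close>.\<close>
    have "?S \<subset> W" using xy nonadjacent by auto
    then obtain z z' where z: "z \<in> ?S" "z' \<in> W - ?S" "{z, z'} \<in> ET"
      using crossing_edge[OF connected_core] by blast
    have xz: "z \<noteq> x" "{x, z} \<in> ET" "z \<in> W" "z' \<noteq> x" "z' \<noteq> z" "z' \<in> W"
      using z tree_edge_neq[OF tree z(3)] by auto
    have d2: "2 \<le> d"
    proof -
      have "finite W" using card_core by (intro card_ge_0_finite) simp
      then have "card {x, z, z'} \<le> card W" using xz xy by (intro card_mono) auto
      then show ?thesis using card_core xz by simp
    qed
    have "incident b \<subseteq> incident a"
    proof
      fix i assume i: "i \<in> incident b"
      show "i \<in> incident a"
      proof (cases "i = e")
        case False
        have "i \<in> B" using incident_core_subset[OF b(1)] i by blast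
        then have "card {a, b} < card (h i \<inter> A)"
          using degB[of i] d2 card_2_iff[of "{a, b}"] \<open>b \<noteq> a\<close> by simp
        then have "\<not> h i \<inter> A \<subseteq> {a, b}"
          using card_mono[of "{a, b}" "h i \<inter> A"] by auto
        then obtain c where c: "c \<in> h i" "c \<in> A" "c \<noteq> a" "c \<noteq> b" by blast
        let ?f = "(\<lambda>_. a)(z := b)" and ?g = "(\<lambda>_. e)({x, z} := e)"
        have emb: "embedding ET {z', z, x} (?f(z' := c)) (?g({z, z'} := i))"
          by (rule embedding_insert[OF tree con[OF xz(2)] _ _ z(3) edge[OF xz(1,2)]])
            (use xz i False c in auto)
        have con': "connected_on ET {z', z, x}"
          by (rule connected_on_insert[OF con[OF xz(2)] z(3)]) simp
        have "(?f(z' := c)) ` {z', z, x} \<subseteq> A" using a b(1) c(2) by auto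
        moreover have "{z', z, x} \<subseteq> W" using xz xy by blast
        \<comment> \<open>The extension still assigns \<open>i\<close> to the edge
          \<open>{z, z'}\<close>, and all its hyperedges are incident to the image \<open>a\<close>
          of \<open>x\<close>.\<close>
        ultimately obtain g' where
          "\<And>e. e \<in> induced_edges ET {z', z, x} \<Longrightarrow> g' e = (?g({z, z'} := i)) e"
          "g' ` induced_edges ET W \<subseteq> incident ((?f(z' := c)) x)"
          using extend_stuck[OF _ con' emb] by (metis insertI1 insertI2)
        moreover have "{z, z'} \<in> induced_edges ET {z', z, x}" "{z, z'} \<in> induced_edges ET W"
          using z(3) xz by (auto simp: induced_edges_def)
        ultimately show ?thesis using xz by fastforce
      qed (use e in simp)
    qed
    then show ?thesis
      using card_incident_core[OF a] card_incident_core[OF b(1)]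
      by (intro card_subset_eq finite_incident) auto
  qed
qed simp

end

section \<open>Weighted incidence count by successive removal\<close>

text \<open>The quantity
  \<open>Suc d * (\<Sum>i\<in>B. card (h i \<inter> A)) - (Suc d * d * card A + r * card B)\<close> does not decrease when
  a vertex of degree at most \<open>d\<close> or a hyperedge with at most \<open>d\<close> vertices in \<open>A\<close> is removed.
  When neither exists, the component of a vertex is complete bipartite, with vertex set \<open>C\<close> and
  \<open>Suc d\<close> hyperedges, and contributes \<open>Suc d * (card C - r)\<close>.\<close>

lemma weighted_incidence_bound:
  assumes "A \<subseteq> V" "B \<subseteq> I"
  shows "Suc d * (\<Sum>i\<in>B. card (h i \<inter> A)) \<le> Suc d * d * card A + r * card B \<and>
    (Suc d * (\<Sum>i\<in>B. card (h i \<inter> A)) = Suc d * d * card A + r * card B \<and> \<not> (A = {} \<and> B = {}) \<longrightarrow>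
      (\<exists>C N. C \<noteq> {} \<and> C \<subseteq> V \<and> N \<subseteq> I \<and> card N = Suc d \<and> (\<forall>i\<in>N. h i = C) \<and>
        (\<forall>v\<in>C. incident v = N)))"
    (is "?P A B")
  using assms
proof (induction "card A + card B" arbitrary: A B rule: less_induct)
  case less
  have finA: "finite A" and finB: "finite B"
    using less.prems finite_vertices finite_index finite_subset by blast+
  consider (vertex) a where "a \<in> A" "card (incident a \<inter> B) \<le> d"
    | (hyperedge) i where "i \<in> B" "card (h i \<inter> A) \<le> d"
    | (core) "\<And>a. a \<in> A \<Longrightarrow> Suc d \<le> card (incident a \<inter> B)"
        "\<And>i. i \<in> B \<Longrightarrow> Suc d \<le> card (h i \<inter> A)"
    by (meson not_less_eq_eq)
  then show ?case
  proof cases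
    case vertex
    let ?A = "A - {a}"
    have cA: "card A = Suc (card ?A)" using card_Suc_Diff1[OF finA vertex(1)] by simp
    have "card (h i \<inter> A) = card (h i \<inter> ?A) + (if a \<in> h i then 1 else 0)" for i
    proof (cases "a \<in> h i")
      case True
      then have "h i \<inter> A = insert a (h i \<inter> ?A)" using vertex(1) by blast
      then show ?thesis using True finA by simp
    next
      case False
      then have "h i \<inter> A = h i \<inter> ?A" by blast
      then show ?thesis using False by simp
    qed
    then have "(\<Sum>i\<in>B. card (h i \<inter> A)) =
        (\<Sum>i\<in>B. card (h i \<inter> ?A)) + (\<Sum>i\<in>B. if a \<in> h i then 1 else 0)"
      by (simp add: sum.distrib)
    also have "(\<Sum>i\<in>B. if a \<in> h i then 1 else 0) = card (B \<inter> {i. a \<in> h i})"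
      using finB by (simp add: sum.If_cases)
    also have "B \<inter> {i. a \<in> h i} = incident a \<inter> B"
      using less.prems(2) by (auto simp: incident_def)
    finally have E: "(\<Sum>i\<in>B. card (h i \<inter> A)) = (\<Sum>i\<in>B. card (h i \<inter> ?A)) + card (incident a \<inter> B)" .
    have IH: "?P ?A B" using cA less.prems by (intro less.hyps) auto
    have le: "Suc d * card (incident a \<inter> B) \<le> Suc d * d"
      using vertex(2) by (rule mult_le_mono2)
    have dist: "Suc d * (\<Sum>i\<in>B. card (h i \<inter> A)) =
        Suc d * (\<Sum>i\<in>B. card (h i \<inter> ?A)) + Suc d * card (incident a \<inter> B)"
      "Suc d * d * card A = Suc d * d * card ?A + Suc d * d"
      unfolding E cA by (simp_all only: distrib_left mult_Suc_right add.commute)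
    \<comment> \<open>Equality passes to the smaller pair, to which the induction hypothesis applies
      only if it is nonempty. If both sets became empty, equality would force
      \<open>Suc d * d * card A = 0\<close>, against \<open>d > 0\<close>.\<close>
    have ne: "\<not> (?A = {} \<and> B = {})"
      if "Suc d * (\<Sum>i\<in>B. card (h i \<inter> A)) = Suc d * d * card A + r * card B"
    proof
      assume "?A = {} \<and> B = {}"
      then have "Suc d * d * card A = 0" using that by simp
      then show False using d_pos cA by simp
    qed
    show ?thesis
    proof (intro conjI impI)
      show "Suc d * (\<Sum>i\<in>B. card (h i \<inter> A)) \<le> Suc d * d * card A + r * card B"
        using IH dist le by linarith
    next
      assume eq: "Suc d * (\<Sum>i\<in>B. card (h i \<inter> A)) = Suc d * d * card A + r * card B \<and>
        \<not> (A = {} \<and> B = {})"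
      then have "Suc d * (\<Sum>i\<in>B. card (h i \<inter> ?A)) = Suc d * d * card ?A + r * card B"
        using IH dist le by linarith
      then show "\<exists>C N. C \<noteq> {} \<and> C \<subseteq> V \<and> N \<subseteq> I \<and> card N = Suc d \<and> (\<forall>i\<in>N. h i = C) \<and>
          (\<forall>v\<in>C. incident v = N)"
        using IH ne eq by blast
    qed
  next
    case hyperedge
    let ?B = "B - {i}"
    have cB: "card B = Suc (card ?B)" using card_Suc_Diff1[OF finB hyperedge(1)] by simp
    have E: "(\<Sum>i\<in>B. card (h i \<inter> A)) = card (h i \<inter> A) + (\<Sum>i\<in>?B. card (h i \<inter> A))"
      by (rule sum.remove[OF finB hyperedge(1)])
    have IH: "?P A ?B" using cB less.prems by (intro less.hyps) auto
    \<comment> \<open>Here \<open>Suc d * d \<le> r\<close> enters: dropping \<open>i\<close> loses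
      no more incidence weight than the term \<open>r\<close> it saves.\<close>
    have le: "Suc d * card (h i \<inter> A) \<le> r"
      using mult_le_mono2[OF hyperedge(2), of "Suc d"] large(2) by linarith
    have dist: "Suc d * (\<Sum>i\<in>B. card (h i \<inter> A)) =
        Suc d * card (h i \<inter> A) + Suc d * (\<Sum>i\<in>?B. card (h i \<inter> A))"
      "r * card B = r + r * card ?B"
      unfolding E cB by (simp_all only: distrib_left mult_Suc_right)
    have ne: "\<not> (A = {} \<and> ?B = {})"
      if "Suc d * (\<Sum>i\<in>B. card (h i \<inter> A)) = Suc d * d * card A + r * card B"
    proof
      assume "A = {} \<and> ?B = {}"
      then have "r * card B = 0" using that by simp
      then show False using large(1) cB by simp
    qed
    show ?thesis
    proof (intro conjI impI)
      show "Suc d * (\<Sum>i\<in>B. card (h i \<inter> A)) \<le> Suc d * d * card A + r * card B"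
        using IH dist le by linarith
    next
      assume eq: "Suc d * (\<Sum>i\<in>B. card (h i \<inter> A)) = Suc d * d * card A + r * card B \<and>
        \<not> (A = {} \<and> B = {})"
      then have "Suc d * (\<Sum>i\<in>?B. card (h i \<inter> A)) = Suc d * d * card A + r * card ?B"
        using IH dist le by linarith
      then show "\<exists>C N. C \<noteq> {} \<and> C \<subseteq> V \<and> N \<subseteq> I \<and> card N = Suc d \<and> (\<forall>i\<in>N. h i = C) \<and>
          (\<forall>v\<in>C. incident v = N)"
        using IH ne eq by blast
    qed
  next
    case core
    show ?thesis
    proof (cases "A = {}")
      case True
      then have "B = {}" using core(2) by fastforce
      then show ?thesis using True by simp
    next
      case False
      then obtain a where a: "a \<in> A" by blast
      let ?N = "incident a"
      let ?C = "{b \<in> A. incident b = ?N}"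
      have cN: "card ?N = Suc d" by (rule card_incident_core[OF less.prems core a])
      have NB: "?N \<subseteq> B" by (rule incident_core_subset[OF less.prems core a])
      \<comment> \<open>Members of \<open>?N\<close> meet \<open>A\<close> exactly in
        \<open>?C\<close>, and by \<open>other\<close> the remaining hyperedges of \<open>B\<close>
        miss \<open>?C\<close>. So the component can be split off without losing incidences.\<close>
      have trace: "h i \<inter> A = ?C" if "i \<in> ?N" for i
      proof -
        have "b \<in> h i" if "incident b = ?N" for b
          using that \<open>i \<in> ?N\<close> by (auto simp: incident_def)
        then show ?thesis using incident_core_eq[OF less.prems core a that] by blast
      qed
      have other: "h i \<inter> A = h i \<inter> (A - ?C)" if "i \<in> B - ?N" for i
      proof -
        have "i \<in> I" using that less.prems(2) by blast
        then have "i \<in> ?N" if "b \<in> h i" "incident b = ?N" for b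
          using that by (auto simp: incident_def)
        then show ?thesis using that by blast
      qed
      obtain e where e: "e \<in> ?N" using cN by fastforce
      have eI: "e \<in> I" using e by (simp add: incident_def)
      have cC: "card ?C \<le> r"
        using card_mono[OF finite_hyperedge[OF eI] Int_lower1, of A]
        unfolding trace[OF e] hyperedge_card[OF eI] .
      have "(\<Sum>i\<in>B. card (h i \<inter> A)) = (\<Sum>i\<in>B - ?N. card (h i \<inter> A)) + (\<Sum>i\<in>?N. card (h i \<inter> A))"
        by (rule sum.subset_diff[OF NB finB])
      also have "(\<Sum>i\<in>?N. card (h i \<inter> A)) = Suc d * card ?C"
        using trace cN by simp
      also have "(\<Sum>i\<in>B - ?N. card (h i \<inter> A)) = (\<Sum>i\<in>B - ?N. card (h i \<inter> (A - ?C)))"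
        using other by (intro sum.cong) auto
      finally have E: "(\<Sum>i\<in>B. card (h i \<inter> A)) = (\<Sum>i\<in>B - ?N. card (h i \<inter> (A - ?C))) + Suc d * card ?C" .
      have cA: "card A = card (A - ?C) + card ?C"
        using card_Diff_subset[of ?C A] card_mono[of A ?C] finA by auto
      have cB: "card B = card (B - ?N) + Suc d"
        using card_Diff_subset[OF finite_incident NB] card_mono[OF finB NB] cN by simp
      have IH: "?P (A - ?C) (B - ?N)" using less.prems cA cB by (intro less.hyps) auto
      define c where "c = card ?C"
      have dist: "Suc d * (\<Sum>i\<in>B. card (h i \<inter> A)) =
          Suc d * (\<Sum>i\<in>B - ?N. card (h i \<inter> (A - ?C))) + (Suc d * d * c + Suc d * c)"
        "Suc d * d * card A = Suc d * d * card (A - ?C) + Suc d * d * c"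
        "r * card B = r * card (B - ?N) + Suc d * r"
        unfolding E cA cB c_def[symmetric] by (simp_all add: algebra_simps)
      have le: "Suc d * c \<le> Suc d * r" using cC unfolding c_def by (rule mult_le_mono2)
      show ?thesis
      proof (intro conjI impI)
        show "Suc d * (\<Sum>i\<in>B. card (h i \<inter> A)) \<le> Suc d * d * card A + r * card B"
          using IH dist le by linarith
      next
        assume "Suc d * (\<Sum>i\<in>B. card (h i \<inter> A)) = Suc d * d * card A + r * card B \<and>
          \<not> (A = {} \<and> B = {})"
        \<comment> \<open>The rest has weight at most zero, so the component must have weight at
          least zero. This gives \<open>c = r\<close>, and every hyperedge of \<open>?N\<close>,
          containing \<open>?C\<close> and having \<open>r\<close> vertices, equals it.\<close>
        then have "Suc d * r \<le> Suc d * c" using IH dist by linarith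
        then have "r \<le> c" using Suc_mult_le_cancel1 by blast
        then have cr: "card ?C = r" using cC unfolding c_def by (rule antisym[rotated])
        have "h i = ?C" if "i \<in> ?N" for i
        proof -
          have "i \<in> I" using that by (simp add: incident_def)
          then show ?thesis
            using trace[OF that] cr hyperedge_card finite_hyperedge by (metis card_subset_eq inf_le1)
        qed
        moreover have "a \<in> ?C" using a by simp
        moreover have "?C \<subseteq> V" using less.prems(1) by blast
        moreover have "?N \<subseteq> I" by (auto simp: incident_def)
        moreover have "\<forall>v\<in>?C. incident v = ?N" by blast
        ultimately show "\<exists>C N. C \<noteq> {} \<and> C \<subseteq> V \<and> N \<subseteq> I \<and> card N = Suc d \<and> (\<forall>i\<in>N. h i = C) \<and>
            (\<forall>v\<in>C. incident v = N)"
          using cN by (intro exI[of _ ?C] exI[of _ ?N]) blast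
      qed
    qed
  qed
qed

text \<open>For the whole family the incidence sum is \<open>r * card I\<close>. Subtracting the
  term \<open>r * card I\<close> from both sides of the weighted bound leaves the common factor
  \<open>d\<close>, which cancels.\<close>

lemma nonstar_bound:
  shows "r * card I \<le> Suc d * card V"
    and "\<lbrakk>r * card I = Suc d * card V; V \<noteq> {}\<rbrakk> \<Longrightarrow>
      \<exists>C N. C \<noteq> {} \<and> C \<subseteq> V \<and> N \<subseteq> I \<and> card N = Suc d \<and> (\<forall>i\<in>N. h i = C) \<and>
        (\<forall>v\<in>C. incident v = N)"
proof -
  have "h i \<inter> V = h i" if "i \<in> I" for i using hyperedge_subset[OF that] by blast
  then have sum: "(\<Sum>i\<in>I. card (h i \<inter> V)) = r * card I"
    using hyperedge_card by simp
  note bound = weighted_incidence_bound[OF order_refl order_refl, unfolded sum]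
  have split: "Suc d * (r * card I) = d * (r * card I) + r * card I"
    "Suc d * d * card V = d * (Suc d * card V)" by (simp_all add: algebra_simps)
  have "d * (r * card I) \<le> d * (Suc d * card V)"
    using bound split by linarith
  then show "r * card I \<le> Suc d * card V" using d_pos by simp
  show "\<exists>C N. C \<noteq> {} \<and> C \<subseteq> V \<and> N \<subseteq> I \<and> card N = Suc d \<and> (\<forall>i\<in>N. h i = C) \<and>
        (\<forall>v\<in>C. incident v = N)" if "r * card I = Suc d * card V" "V \<noteq> {}"
  proof -
    have "Suc d * (r * card I) = Suc d * d * card V + r * card I"
      using split that(1) by simp
    then show ?thesis using bound that(2) by blast
  qed
qed

end

subsection \<open>Extremal multi-hypergraphs\<close>

text \<open>Listing the multiset and taking positions as indices separates repeated
  hyperedges.\<close>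

lemma uniform_hypergraph_as_family:
  assumes "uniform_multi_hypergraph n r V H"
  obtains I :: "nat set" and h where "uniform_family V I h r" "H = image_mset h (mset_set I)"
proof -
  obtain xs where xs: "mset xs = H" using ex_mset by blast
  have eq: "H = image_mset ((!) xs) (mset_set {..<length xs})"
    using xs by (metis lessThan_atLeast0 map_nth mset_map mset_set_upto_eq_mset_upto mset_upt)
  have "uniform_family V {..<length xs} ((!) xs) r"
    using assms xs unfolding uniform_multi_hypergraph_def by unfold_locales auto
  then show ?thesis using eq by (rule that)
qed

text \<open>The copy is given by \<open>f\<close> and \<open>h \<circ> g\<close>. Injectivity of
  \<open>g\<close> ensures that no hyperedge is used beyond its multiplicity, even where
  \<open>h\<close> repeats values.\<close>

lemma (in uniform_family) embedding_contains_berge: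
  assumes tr: "tree VT E" and emb: "embedding E VT f g"
  shows "contains_berge VT E V (image_mset h (mset_set I))"
proof -
  note ind = induced_edges_all[OF tr]
  have g: "inj_on g E" "g ` E \<subseteq> I" using emb by (simp_all add: embedding_def ind)
  have "image_mset (h \<circ> g) (mset_set E) = image_mset h (mset_set (g ` E))"
    using image_mset_mset_set[OF g(1)] by (metis image_mset.compositionality)
  moreover have "mset_set (g ` E) \<subseteq># mset_set I"
    using g(2) finite_index by (intro subset_imp_msubset_mset_set)
  ultimately have "image_mset (h \<circ> g) (mset_set E) \<subseteq># image_mset h (mset_set I)"
    by (simp add: image_mset_subseteq_mono)
  moreover have "berge_copy VT E V (image_mset (h \<circ> g) (mset_set E))"
    unfolding berge_copy_def
    using emb ind by (intro exI[of _ f] exI[of _ "h \<circ> g"]) (auto simp: embedding_def)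
  ultimately show ?thesis unfolding contains_berge_def by blast
qed

lemma (in uniform_family) hdegree_eq_card_incident:
  "hdegree (image_mset h (mset_set I)) v = card (incident v)"
  using finite_index by (simp add: hdegree_def incident_def filter_mset_image_mset)

section \<open>Degree sums and stars\<close>

lemma sum_hdegree:
  assumes "uniform_multi_hypergraph n r V H"
  shows "(\<Sum>v\<in>V. hdegree H v) = r * size H"
proof -
  have fin: "finite V" using assms by (simp add: uniform_multi_hypergraph_def)
  have "\<forall>h\<in>#H. h \<subseteq> V \<and> card h = r" using assms by (simp add: uniform_multi_hypergraph_def)
  then show ?thesis
  proof (induction H)
    case empty
    then show ?case by (simp add: hdegree_def)
  next
    case (add h H)
    have "hdegree (add_mset h H) v = hdegree H v + (if v \<in> h then 1 else 0)" for v
      by (simp add: hdegree_def)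
    then have "(\<Sum>v\<in>V. hdegree (add_mset h H) v) = r * size H + card (V \<inter> h)"
      using add fin by (simp add: sum.distrib sum.If_cases)
    moreover have "V \<inter> h = h" "card h = r" using add.prems by auto
    ultimately show ?case by simp
  qed
qed

text \<open>By connectivity an edge would leave the closed neighbourhood of \<open>c\<close>; as it
  contains \<open>c\<close>, its outer end would be a neighbour of \<open>c\<close> after
  all.\<close>

lemma star_vertices:
  assumes "tree VT E" and "c \<in> VT" and "\<forall>e\<in>E. c \<in> e"
  shows "insert c {w. {c, w} \<in> E} = VT"
proof (rule ccontr)
  let ?S = "insert c {w. {c, w} \<in> E}"
  assume ne: "?S \<noteq> VT"
  have "?S \<subseteq> VT" using assms(2) tree_edgeD(1)[OF assms(1)] by auto
  then have "?S \<subset> VT" using ne by (simp only: psubset_eq simp_thms)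
  then obtain u w where uw: "u \<in> ?S" "w \<in> VT - ?S" "{u, w} \<in> E"
    using crossing_edge[OF tree_connected_on[OF assms(1)]] by blast
  have w: "w \<noteq> c" "{c, w} \<notin> E" using uw(2) by auto
  moreover have "c \<in> {u, w}" using assms(3) uw(3) by (rule bspec)
  ultimately show False using uw(3) by (metis empty_iff insert_iff)
qed

text \<open>The centre goes to \<open>v\<close> and leaves are added one at a time. Before each
  addition fewer than \<open>card E\<close> hyperedges are used and at most \<open>card E\<close>
  vertices occupied, against degree at least \<open>card E\<close> at \<open>v\<close> and
  hyperedges of size \<open>r > card E\<close>.\<close>

lemma (in uniform_family) star_embedding:
  assumes tr: "tree VT E" and c: "c \<in> VT" "\<forall>e\<in>E. c \<in> e"
    and v: "v \<in> V" "card E \<le> card (incident v)" and large: "card E < r"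
  obtains f g where "embedding E VT f g"
proof -
  let ?N = "{w. {c, w} \<in> E}"
  have NV: "insert c ?N = VT" by (rule star_vertices[OF tr c])
  have finN: "finite ?N" using NV tree_finite(1)[OF tr] by (metis finite_insert)
  have cardV: "card VT = Suc (card E)"
    using card_induced_edges[OF tr order_refl tree_connected_on[OF tr]] induced_edges_all[OF tr]
    by simp
  have "X \<subseteq> ?N \<Longrightarrow> \<exists>f g. embedding E (insert c X) f g \<and> f c = v" if "finite X" for X
    using that
  proof (induction X rule: finite_induct)
    case empty
    show ?case using embedding_singleton[OF tr v(1)] by blast
  next
    case (insert w X)
    let ?S = "insert c X"
    obtain f g where fg: "embedding E ?S f g" "f c = v" using insert by auto
    have cw: "{c, w} \<in> E" using insert.prems by simp
    have wS: "w \<notin> ?S" using insert.hyps tree_edge_neq[OF tr cw] by simp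
    have con: "connected_on E ?S"
      using insert by (intro connected_on_neighbours) auto
    have "?S \<subset> VT" using insert.prems NV wS by blast
    then have SV: "?S \<subseteq> VT" "card ?S < Suc (card E)"
      using psubset_card_mono[OF tree_finite(1)[OF tr], of ?S] cardV by auto
    note cards = card_embedding_image[OF tr SV(1) con fg(1)]
    have "\<not> incident v \<subseteq> g ` induced_edges E ?S"
      using card_mono[of "g ` induced_edges E ?S" "incident v"] cards(2) SV(2) v(2)
        tree_finite(2)[OF tr] by (auto simp: induced_edges_def)
    then obtain i where i: "i \<in> incident (f c)" "i \<notin> g ` induced_edges E ?S" using fg(2) by blast
    have "card (h i) = r" using i(1) hyperedge_card by (simp add: incident_def)
    then have "\<not> h i \<subseteq> f ` ?S"
      using card_mono[of "f ` ?S" "h i"] cards(1) SV(2) large insert.hyps(1) by auto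
    then obtain b where b: "b \<in> h i" "b \<notin> f ` ?S" by blast
    have "embedding E (insert w ?S) (f(w := b)) (g({c, w} := i))"
      by (rule embedding_insert[OF tr con insertI1 wS cw fg(1) i b])
    moreover have "(f(w := b)) c = v" using fg(2) wS by auto
    ultimately show ?case by (metis insert_commute)
  qed
  then show ?thesis using that finN NV by (metis order_refl)
qed

text \<open>All hyperedges of a Berge star pass through the image of the centre. Conversely, a
  vertex of large degree serves as centre by \<open>star_embedding\<close>.\<close>

lemma contains_berge_star_iff:
  assumes st: "star VT E" and u: "uniform_multi_hypergraph n r V H" and large: "card E < r"
  shows "contains_berge VT E V H \<longleftrightarrow> (\<exists>v\<in>V. card E \<le> hdegree H v)"
proof
  obtain c where tr: "tree VT E" and c: "c \<in> VT" "\<forall>e\<in>E. c \<in> e"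
    using st by (auto simp: star_def)
  {
    assume "contains_berge VT E V H"
    then obtain H' f1 f2 where H': "H' \<subseteq># H" "f1 ` VT \<subseteq> V" "image_mset f2 (mset_set E) = H'"
      and inc: "\<forall>v1 v2. {v1, v2} \<in> E \<longrightarrow> {f1 v1, f1 v2} \<subseteq> f2 {v1, v2}"
      unfolding contains_berge_def berge_copy_def by blast
    have "f1 c \<in> f2 e" if e: "e \<in> E" for e
    proof -
      obtain a b where "e = {a, b}" using tree_edgeD(2)[OF tr e] by (auto simp: card_2_iff)
      moreover have "c \<in> e" using c(2) e by blast
      ultimately obtain w where "e = {c, w}" by (metis insert_commute insertE singletonD)
      then show ?thesis using inc e by auto
    qed
    then have "filter_mset (\<lambda>e. f1 c \<in> e) H' = H'"
      using tree_finite(2)[OF tr] H'(3) by (auto simp: filter_mset_eq_conv)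
    then have "hdegree H' (f1 c) = card E"
      using H'(3) by (auto simp: hdegree_def)
    moreover have "hdegree H' (f1 c) \<le> hdegree H (f1 c)"
      unfolding hdegree_def using H'(1) by (intro size_mset_mono multiset_filter_mono)
    ultimately show "\<exists>v\<in>V. card E \<le> hdegree H v" using H'(2) c(1) by auto
  }
  assume "\<exists>v\<in>V. card E \<le> hdegree H v"
  then obtain v where v: "v \<in> V" "card E \<le> hdegree H v" by blast
  obtain I :: "nat set" and h where fam: "uniform_family V I h r" and H: "H = image_mset h (mset_set I)"
    by (rule uniform_hypergraph_as_family[OF u])
  interpret uniform_family V I h r by (rule fam)
  obtain f g where "embedding E VT f g"
    using star_embedding[OF tr c v(1) _ large] v(2) H hdegree_eq_card_incident by metis
  then show "contains_berge VT E V H" using embedding_contains_berge[OF tr] H by simp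
qed

lemma star_bound:
  assumes st: "star VT E" and "card E > 0" and u: "uniform_multi_hypergraph n r V H"
    and large: "card E < r" and free: "\<not> contains_berge VT E V H"
  shows "r * size H \<le> n * (card E - 1)"
    and "r * size H = n * (card E - 1) \<Longrightarrow> regular_multi_hypergraph (card E - 1) V H"
proof -
  have fin: "finite V" "card V = n" using u by (auto simp: uniform_multi_hypergraph_def)
  have deg: "hdegree H v \<le> card E - 1" if "v \<in> V" for v
    using contains_berge_star_iff[OF st u large] free that by fastforce
  have "(\<Sum>v\<in>V. hdegree H v) \<le> (\<Sum>v\<in>V. card E - 1)" by (rule sum_mono) (rule deg)
  then show "r * size H \<le> n * (card E - 1)" using sum_hdegree[OF u] fin by simp
  show "regular_multi_hypergraph (card E - 1) V H" if "r * size H = n * (card E - 1)"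
    unfolding regular_multi_hypergraph_def
  proof (rule ccontr)
    assume "\<not> (\<forall>v\<in>V. hdegree H v = card E - 1)"
    then obtain v where "v \<in> V" "hdegree H v < card E - 1" using deg by fastforce
    then have "(\<Sum>v\<in>V. hdegree H v) < (\<Sum>v\<in>V. card E - 1)"
      using deg fin by (intro sum_strict_mono_ex1) auto
    then show False using that sum_hdegree[OF u] fin by simp
  qed
qed

lemma star_regular:
  assumes st: "star VT E" and "card E > 0" and u: "uniform_multi_hypergraph n r V H"
    and large: "card E < r" and reg: "regular_multi_hypergraph (card E - 1) V H"
  shows "\<not> contains_berge VT E V H" and "r * size H = n * (card E - 1)"
proof -
  show "\<not> contains_berge VT E V H"
    using contains_berge_star_iff[OF st u large] reg assms(2)
    by (auto simp: regular_multi_hypergraph_def)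
  show "r * size H = n * (card E - 1)"
    using sum_hdegree[OF u] reg u
    by (simp add: regular_multi_hypergraph_def uniform_multi_hypergraph_def)
qed

section \<open>Bound and extremal hypergraphs for trees that are not stars\<close>

lemma nonstar_free_family:
  assumes tr: "tree VT E" and ns: "\<not> star VT E"
    and u: "uniform_multi_hypergraph n r V H" and large: "card E < r" "(card E - 1) * (card E - 2) \<le> r"
    and free: "\<not> contains_berge VT E V H"
  obtains I :: "nat set" and h W p q x y d where "nonstar_free_family V I h r VT E W p q x y d"
    "H = image_mset h (mset_set I)" "Suc d = card E - 1"
proof -
  obtain I :: "nat set" and h where fam: "uniform_family V I h r" and H: "H = image_mset h (mset_set I)"
    by (rule uniform_hypergraph_as_family[OF u])
  interpret uniform_family V I h r by (rule fam)
  obtain p q W x y where W: "insert p (insert q W) = VT" "x \<in> W" "y \<in> W" "x \<noteq> y"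
    "p \<notin> W" "q \<notin> W" "p \<noteq> q" "{x, p} \<in> E" "{y, q} \<in> E" "connected_on E W"
    by (rule nonstar_tree_two_leaves[OF tr ns])
  have finW: "finite W" using tree_finite(1)[OF tr] W(1) by (metis finite_insert)
  have "card VT = Suc (card E)"
    using card_induced_edges[OF tr order_refl tree_connected_on[OF tr]] induced_edges_all[OF tr]
    by simp
  moreover have "card VT = Suc (Suc (card W))"
    using W(5-7) finW by (simp flip: W(1))
  \<comment> \<open>The tree has \<open>card E + 1\<close> vertices, and two leaves are missing from
    \<open>W\<close>; this makes \<open>d\<close> equal to \<open>card E - 2\<close>.\<close>
  ultimately have card: "card E = Suc (card W)" by simp
  then obtain d where d: "card W = Suc d"
    using W(2) finW by (metis card_gt_0_iff empty_iff gr0_implies_Suc)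
  have "nonstar_free_family V I h r VT E W p q x y d"
    using W tr d card large embedding_contains_berge[OF tr] free H
    by unfold_locales auto
  then show ?thesis using H card d by (intro that) auto
qed

lemma nonstar_size_bound:
  assumes "tree VT E" and "\<not> star VT E"
    and u: "uniform_multi_hypergraph n r V H" and "card E < r" "(card E - 1) * (card E - 2) \<le> r"
    and "\<not> contains_berge VT E V H"
  shows "r * size H \<le> n * (card E - 1)"
proof -
  obtain I :: "nat set" and h W p q x y d where "nonstar_free_family V I h r VT E W p q x y d"
    and H: "H = image_mset h (mset_set I)" and d: "Suc d = card E - 1"
    by (rule nonstar_free_family[OF assms])
  then interpret nonstar_free_family V I h r VT E W p q x y d by simp
  show ?thesis
    using nonstar_bound(1) H d u by (simp add: uniform_multi_hypergraph_def mult.commute)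
qed

lemma contains_berge_mono:
  assumes "contains_berge VT E V' H'" and "V' \<subseteq> V" and "H' \<subseteq># H"
  shows "contains_berge VT E V H"
proof -
  have "berge_copy VT E V H''" if "berge_copy VT E V' H''" for H''
    using that assms(2) unfolding berge_copy_def by (elim ex_forward) blast
  then show ?thesis
    using assms(1,3) unfolding contains_berge_def by (meson subset_mset.order_trans)
qed

text \<open>An extremal hypergraph contains \<open>card E - 1\<close> copies of one hyperedge that meet no other
  hyperedge; removing them leaves an extremal hypergraph.\<close>

lemma nonstar_extremal:
  assumes tr: "tree VT E" and ns: "\<not> star VT E"
    and large: "card E < r" "(card E - 1) * (card E - 2) \<le> r"
    and "uniform_multi_hypergraph n r V H" and "\<not> contains_berge VT E V H"
    and "r * size H = n * (card E - 1)"
  shows "r dvd n \<and> disjoint_repeated_hyperedges (n div r) (card E - 1) V H"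
  using assms(5-)
proof (induction n arbitrary: V H rule: less_induct)
  case (less n)
  note u = less.prems(1)
  have V: "finite V" "card V = n" using u by (auto simp: uniform_multi_hypergraph_def)
  show ?case
  proof (cases "n = 0")
    case True
    then have "V = {}" "H = {#}" using V less.prems(3) large(1) by auto
    then show ?thesis using True by (simp add: disjoint_repeated_hyperedges_def)
  next
    case False
    obtain I :: "nat set" and h W p q x y d where "nonstar_free_family V I h r VT E W p q x y d"
      and H: "H = image_mset h (mset_set I)" and d: "Suc d = card E - 1"
      by (rule nonstar_free_family[OF tr ns u large less.prems(2)])
    then interpret nonstar_free_family V I h r VT E W p q x y d by simp
    have "r * card I = Suc d * card V" using less.prems(3) H d V(2) by (simp add: mult.commute)
    moreover have "V \<noteq> {}" using V(2) False by auto
    ultimately obtain C N where C: "C \<noteq> {}" "C \<subseteq> V" "N \<subseteq> I" "card N = Suc d"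
        "\<forall>i\<in>N. h i = C" "\<forall>v\<in>C. incident v = N"
      using nonstar_bound(2) by blast
    define K where "K = image_mset h (mset_set (I - N))"
    have finN: "finite N" using C(3) finite_index finite_subset by blast
    have "mset_set I = mset_set (I - N) + mset_set N"
      using finite_index C(3) finN by (metis Diff_disjoint Diff_partition finite_Diff inf_commute
          mset_set_Union sup_commute)
    moreover have "image_mset h (mset_set N) = replicate_mset (Suc d) C"
    proof -
      have "image_mset h (mset_set N) = image_mset (\<lambda>_. C) (mset_set N)"
        using C(5) finN by (intro image_mset_cong) auto
      then show ?thesis using C(4) by (simp add: image_mset_const_eq)
    qed
    ultimately have split: "H = K + replicate_mset (Suc d) C" using H by (simp add: K_def)
    \<comment> \<open>All hyperedges at a vertex of \<open>C\<close> are indexed by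
      \<open>N\<close>, and \<open>K\<close> consists of the others.\<close>
    have disj: "e \<inter> C = {}" if "e \<in># K" for e
    proof -
      obtain i where i: "i \<in> I" "i \<notin> N" "e = h i"
        using \<open>e \<in># K\<close> finite_index by (auto simp: K_def)
      have False if "v \<in> h i" "v \<in> C" for v
        using C(6) that i(1,2) by (auto simp: incident_def)
      then show ?thesis using i(3) by blast
    qed
    have "N \<noteq> {}" using C(4) by auto
    then obtain i where "i \<in> N" by blast
    then have "h i = C" "i \<in> I" using C(3,5) by auto
    then have cC: "card C = r" using hyperedge_card by auto
    have finC: "finite C" using C(2) V(1) finite_subset by blast
    have rn: "r \<le> n" using card_mono[OF V(1) C(2)] cC V(2) by simp
    have r0: "r > 0" using large(1) by simp
    have u': "uniform_multi_hypergraph (n - r) r (V - C) K"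
      using u disj V(1) cC V(2) C(2) finC split
      by (auto simp: uniform_multi_hypergraph_def card_Diff_subset)
    have free': "\<not> contains_berge VT E (V - C) K"
      using contains_berge_mono[of VT E "V - C" K V H] less.prems(2) split
      by (metis Diff_subset mset_subset_eq_add_left)
    have size': "r * size K = (n - r) * (card E - 1)"
    proof -
      have "size H = size K + Suc d" using arg_cong[OF split, of size] by simp
      then have "r * size K + r * Suc d = n * Suc d"
        using less.prems(3) unfolding d[symmetric] by (simp only: distrib_left)
      then show ?thesis unfolding d[symmetric] diff_mult_distrib by linarith
    qed
    have IH: "r dvd n - r" "disjoint_repeated_hyperedges ((n - r) div r) (card E - 1) (V - C) K"
      using less.IH[OF _ u' free' size'] r0 False by auto
    have dvd: "r dvd n" using IH(1) rn by (metis dvd_add_triv_right_iff le_add_diff_inverse2)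
    have q: "n div r = Suc ((n - r) div r)" using rn r0 by (simp add: le_div_geq)
    have set: "set_mset H = insert C (set_mset K)" using split by (simp add: Un_commute)
    \<comment> \<open>A further copy of the nonempty set \<open>C\<close> would meet
      \<open>C\<close>, so its multiplicity in \<open>H\<close> is exactly
      \<open>Suc d\<close>.\<close>
    have CH: "C \<notin># K" using disj[of C] C(1) by blast
    have "count H e = card E - 1" if "e \<in># H" for e
    proof (cases "e = C")
      case True
      then show ?thesis using CH d by (simp add: split not_in_iff)
    next
      case False
      then have "e \<in># K" using that set by simp
      then show ?thesis
        using IH(2) False by (simp add: split disjoint_repeated_hyperedges_def)
    qed
    moreover have "card (set_mset H) = n div r"
      using IH(2) CH unfolding set q disjoint_repeated_hyperedges_def by simp
    moreover have "disjoint (set_mset H)"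
      using IH(2) disj unfolding set disjoint_repeated_hyperedges_def
      by (auto simp: disjoint_def)
    moreover have "\<Union>(set_mset H) = V"
      using IH(2) C(2) unfolding set disjoint_repeated_hyperedges_def by auto
    ultimately show ?thesis using dvd unfolding disjoint_repeated_hyperedges_def by blast
  qed
qed

lemma disjoint_repeated_hyperedges_size:
  assumes "r dvd n" and "disjoint_repeated_hyperedges (n div r) m V H"
  shows "r * size H = n * m"
proof -
  have "size H = (\<Sum>h\<in>set_mset H. count H h)" by (rule size_multiset_overloaded_eq)
  also have "\<dots> = (n div r) * m"
    using assms(2) by (simp add: disjoint_repeated_hyperedges_def)
  finally show ?thesis using assms(1) by (auto simp: dvd_def)
qed

section \<open>All trees: size bound and extremal number\<close>

lemma berge_tree_size_bound:
  assumes "tree VT E" and "card E > 0" and "card E < r" "(card E - 1) * (card E - 2) \<le> r"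
    and "uniform_multi_hypergraph n r V H" and "\<not> contains_berge VT E V H"
  shows "r * size H \<le> n * (card E - 1)"
  using assms star_bound(1)[OF _ assms(2,5,3,6)] nonstar_size_bound[OF assms(1) _ assms(5,3,4,6)]
  by blast

text \<open>The maximum is attained: sizes are bounded by \<open>n * (card E - 1)\<close>, and the
  empty hypergraph qualifies because the tree has an edge. The bound for a single hypergraph then
  applies to it.\<close>

lemma ex_multi_bound:
  assumes tr: "tree VT E" and k: "card E > 0" and large: "card E < r" "(card E - 1) * (card E - 2) \<le> r"
  shows "r * ex_multi r n VT E \<le> n * (card E - 1)"
proof -
  let ?X = "{size H | (V :: nat set) H. uniform_multi_hypergraph n r V H \<and> \<not> contains_berge VT E V H}"
  have bound: "r * s \<le> n * (card E - 1)" if "s \<in> ?X" for s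
    using that berge_tree_size_bound[OF tr k large] by blast
  have "s \<le> n * (card E - 1)" if "s \<in> ?X" for s
  proof -
    have "1 * s \<le> r * s" using large(1) by (intro mult_le_mono1) simp
    then show ?thesis using bound[OF that] by linarith
  qed
  then have fin: "finite ?X" by (meson finite_nat_set_iff_bounded_le)
  have "\<not> contains_berge VT E {..<n} {#}"
    using tree_finite(2)[OF tr] k by (auto simp: contains_berge_def berge_copy_def mset_set_empty_iff)
  moreover have "uniform_multi_hypergraph n r {..<n} {#}"
    by (simp add: uniform_multi_hypergraph_def)
  ultimately have "?X \<noteq> {}" by blast
  then show ?thesis using bound[OF Max_in[OF fin]] by (simp add: ex_multi_def)
qed

text \<open>Clears the denominator, so that all counting stays in the natural numbers;
  \<open>k > 0\<close> makes the truncated difference \<open>k - 1\<close> agree with the real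
  one.\<close>

lemma real_ratio_iff:
  fixes n k r s :: nat
  assumes "k > 0" and "r > 0"
  shows "real s \<le> real n * (real k - 1) / real r \<longleftrightarrow> r * s \<le> n * (k - 1)"
    and "real s = real n * (real k - 1) / real r \<longleftrightarrow> r * s = n * (k - 1)"
proof -
  have k: "real n * (real k - 1) = real (n * (k - 1))" using assms(1) by (simp add: of_nat_diff)
  have "real s \<le> real n * (real k - 1) / real r \<longleftrightarrow> real (r * s) \<le> real (n * (k - 1))"
    unfolding k using assms(2) by (simp add: pos_le_divide_eq mult.commute del: of_nat_diff)
  then show "real s \<le> real n * (real k - 1) / real r \<longleftrightarrow> r * s \<le> n * (k - 1)"
    by (simp only: of_nat_le_iff)
  have "real s = real n * (real k - 1) / real r \<longleftrightarrow> real (r * s) = real (n * (k - 1))"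
    unfolding k using assms(2) by (simp add: eq_divide_eq mult.commute del: of_nat_diff)
  then show "real s = real n * (real k - 1) / real r \<longleftrightarrow> r * s = n * (k - 1)"
    by (simp only: of_nat_eq_iff)
qed

theorem theorem3:
  fixes n k r :: nat and VT :: "'a set" and ET :: "'a set set"
  assumes "n > 0" and "k > 0" and "r > 0"
    and "tree VT ET" and "card ET = k"
    and "r \<ge> (k - 1) * (k - 2)"
    and "r > k" (* automatic for k >= 4; for k <= 3 the bound fails without it *)
  shows
    "(\<forall>(V :: 'b set) H. uniform_multi_hypergraph n r V H \<and> \<not> contains_berge VT ET V H \<longrightarrow>
        real (size H) \<le> real n * (real k - 1) / real r) \<and>
     real (ex_multi r n VT ET) \<le> real n * (real k - 1) / real r \<and>
     (r > (k - 1) * (k - 2) \<and> \<not> star VT ET \<longrightarrow>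
        (\<forall>(V :: 'b set) H. uniform_multi_hypergraph n r V H \<and> \<not> contains_berge VT ET V H \<longrightarrow>
           (real (size H) = real n * (real k - 1) / real r \<longleftrightarrow>
              r dvd n \<and> disjoint_repeated_hyperedges (n div r) (k - 1) V H))) \<and>
     (star VT ET \<longrightarrow>
        (\<forall>(V :: 'b set) H. uniform_multi_hypergraph n r V H \<longrightarrow>
           (\<not> contains_berge VT ET V H \<and> real (size H) = real n * (real k - 1) / real r \<longleftrightarrow>
              regular_multi_hypergraph (k - 1) V H)))"
proof -
  note iffs = real_ratio_iff[OF assms(2,3)]
  have k: "card ET > 0" "card ET < r" "(card ET - 1) * (card ET - 2) \<le> r"
    using assms by simp_all
  note bound = berge_tree_size_bound[OF assms(4) k, unfolded assms(5)]
  note ex = ex_multi_bound[OF assms(4) k, unfolded assms(5)]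
  have nonstar: "r * size H = n * (k - 1) \<longleftrightarrow>
      r dvd n \<and> disjoint_repeated_hyperedges (n div r) (k - 1) V H"
    if "\<not> star VT ET" "uniform_multi_hypergraph n r V H" "\<not> contains_berge VT ET V H"
    for V :: "'b set" and H
    using nonstar_extremal[OF assms(4) that(1) k(2,3) that(2,3)] disjoint_repeated_hyperedges_size
      assms(5) by blast
  have star: "\<not> contains_berge VT ET V H \<and> r * size H = n * (k - 1) \<longleftrightarrow>
      regular_multi_hypergraph (k - 1) V H"
    if "star VT ET" "uniform_multi_hypergraph n r V H" for V :: "'b set" and H
    using star_bound(2)[OF that(1) k(1) that(2) k(2)] star_regular[OF that(1) k(1) that(2) k(2)]
      assms(5) by blast
  show ?thesis unfolding iffs using bound ex nonstar star by blast
qed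

end
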